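(* For every set $\Gamma$ of formulas and every formula $\alpha$ of the labelled modal natural deduction system $\mathsf{MS}^{p}_{QR}$ described below, $\Gamma \vdash \alpha$ (derivability in $\mathsf{MS}^{p}_{QR}$) holds if and only if $\Gamma \vDash \alpha$ (semantic consequence with respect to the frames described below).
   Context: Syntax. Fix a denumerable set of labels $x_0,x_1,\dots$ (metavariables $x,y,z$) and a denumerable set of propositional symbols. Modal formulas (m-formulas) are built from $\bot$ and propositional symbols using $\to$ and two unary modal operators $\Box$ and $\boxdot$; $\neg A$ abbreviates $A\to\bot$. Relational formulas (r-formulas) are expressions $x\,\mathsf{U}\,y$ and $x\,\mathsf{P}\,y$ with $x,y$ labels. Labelled formulas are $x:A$ with $x$ a label and $A$ an m-formula. A formula is an r-formula or a labelled formula. For a formula $\alpha(x)$ in which label $x$ occurs, $\alpha(y/x)$ denotes the result of replacing every occurrence of $x$ by $y$. Rules of $\mathsf{MS}^{p}_{QR}$ (natural deduction, standard notion of discharged/open assumptions): ($\to I$) if $x:B$ is derived from the assumption $x:A$, infer $x:A\to B$, discharging $x:A$. ($\to E$) from $x:A\to B$ and $x:A$ infer $x:B$. ($RAA$) if $y:\bot$ (for any label $y$) is derived from the assumption $x:\neg A$, infer $x:A$, discharging $x:\neg A$. ($\bot E$) from $x:\bot$ infer any formula $\alpha$. For each pair $(\bigstar,R)\in\{(\Box,\mathsf{U}),(\boxdot,\mathsf{P})\}$: ($\bigstar I$) if $y:A$ is derived from the assumption $x\,R\,y$, where $y$ is different from $x$ and does not occur in any open assumption on which $y:A$ depends other than $x\,R\,y$,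 infer $x:\bigstar A$, discharging $x\,R\,y$; ($\bigstar E$) from $x:\bigstar A$ and $x\,R\,y$ infer $y:A$. ($\mathsf{U}$refl) infer $x\,\mathsf{U}\,x$; ($\mathsf{U}$symm) from $x\,\mathsf{U}\,y$ infer $y\,\mathsf{U}\,x$; ($\mathsf{U}$trans) from $x\,\mathsf{U}\,y$ and $y\,\mathsf{U}\,z$ infer $x\,\mathsf{U}\,z$. ($\mathsf{P}\mathsf{U}I$) from $x\,\mathsf{P}\,y$ infer $x\,\mathsf{U}\,y$. ($\mathsf{P}$trans) from $x\,\mathsf{P}\,y$ and $y\,\mathsf{P}\,z$ infer $x\,\mathsf{P}\,z$. ($class$) if $\alpha$ is derived from the assumptions $x\,\mathsf{P}\,y$ and $y\,\mathsf{P}\,y$, where $y$ is different from $x$ and does not occur in $\alpha$ nor in any open assumption on which $\alpha$ depends other than $x\,\mathsf{P}\,y$ and $y\,\mathsf{P}\,y$, infer $\alpha$, discharging both. ($\mathsf{P}$sub1) from $\alpha(x)$, $x\,\mathsf{P}\,x$ and $x\,\mathsf{P}\,y$ infer $\alpha(y/x)$; ($\mathsf{P}$sub2) from $\alpha(y)$, $x\,\mathsf{P}\,x$ and $x\,\mathsf{P}\,y$ infer $\alpha(x/y)$. $\Gamma\vdash\alpha$ means there is a derivation tree built from these rules ending in $\alpha$ whose open assumptions form a finite subset of $\Gamma$. Semantics. A frame is $\langle W,U,P\rangle$ with $W$ a nonempty set, $U\subseteq W\times W$ an equivalence relation, $P\subseteq W\times W$, satisfying: (1) $vPw\Rightarrow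 vUw$; (2) $vPw'$ and $w'Pw''$ imply $vPw''$; (3) for every $v$ there is $w$ with $vPw$ and $wPw$; (4) $vPv$ and $vPw$ imply $v=w$. A model adds $V:W\to 2^{\mathrm{Prop}}$. Truth at a world: $w\vDash r$ iff $r\in V(w)$; $w\nvDash\bot$; $w\vDash A\to B$ iff $w\vDash A$ implies $w\vDash B$; $w\vDash\Box A$ iff $w'\vDash A$ for all $w'$ with $wUw'$; $w\vDash\boxdot A$ iff $w'\vDash A$ for all $w'$ with $wPw'$. An interpretation $\mathscr{I}$ maps labels to worlds; $\mathscr{M},\mathscr{I}\vDash x:A$ iff $\mathscr{M},\mathscr{I}(x)\vDash A$; $\mathscr{M},\mathscr{I}\vDash x\,\mathsf{U}\,y$ iff $\mathscr{I}(x)U\mathscr{I}(y)$; $\mathscr{M},\mathscr{I}\vDash x\,\mathsf{P}\,y$ iff $\mathscr{I}(x)P\mathscr{I}(y)$. $\Gamma\vDash\alpha$ iff for every model $\mathscr{M}$ (over such a frame) and every interpretation $\mathscr{I}$, if $\mathscr{M},\mathscr{I}\vDash\gamma$ for all $\gamma\in\Gamma$ then $\mathscr{M},\mathscr{I}\vDash\alpha$. *)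

theory Defs
  imports Main
begin

section \<open>Syntax\<close>

type_synonym label = nat
type_synonym prop_symbol = nat

text \<open>\<open>\<box>\<close> is the modality of \<open>U\<close>; \<open>\<boxdot>\<close> (box with a dot) is the modality of \<open>P\<close>.\<close>

datatype mfm =
    Bot
  | Atom prop_symbol
  | Imp mfm mfm
  | Box mfm
  | DotBox mfm

abbreviation Neg :: "mfm \<Rightarrow> mfm" where
  "Neg A \<equiv> Imp A Bot"

datatype fm =
    RelU label label
  | RelP label label
  | Lab label mfm

primrec labels :: "fm \<Rightarrow> label set" where
  "labels (RelU x y) = {x, y}"
| "labels (RelP x y) = {x, y}"
| "labels (Lab x A) = {x}"

text \<open>\<open>subst \<alpha> y x\<close> is \<open>\<alpha>(y/x)\<close>: every occurrence of \<open>x\<close> in \<open>\<alpha>\<close> is replaced by \<open>y\<close>.\<close>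

primrec subst :: "fm \<Rightarrow> label \<Rightarrow> label \<Rightarrow> fm" where
  "subst (RelU u v) y x = RelU (if u = x then y else u) (if v = x then y else v)"
| "subst (RelP u v) y x = RelP (if u = x then y else u) (if v = x then y else v)"
| "subst (Lab u A) y x = Lab (if u = x then y else u) A"


section \<open>Natural deduction\<close>

text \<open>
  \<open>derivation S \<alpha>\<close>: there is a derivation tree with conclusion \<open>\<alpha>\<close> whose set of open
  assumptions is exactly \<open>S\<close>. A discharging rule closes all open occurrences (possibly none)
  of the discharged assumption.
  Since \<open>S\<close> is exact, the eigenvariable conditions range over precisely the assumptions on
  which the premise depends.
\<close>

inductive derivation :: "fm set \<Rightarrow> fm \<Rightarrow> bool" where
  Assm: "derivation {\<alpha>} \<alpha>"
| ImpI: "derivation S (Lab x B) \<Longrightarrow> derivation (S - {Lab x A}) (Lab x (Imp A B))"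
| ImpE: "derivation S (Lab x (Imp A B)) \<Longrightarrow> derivation T (Lab x A) \<Longrightarrow>
    derivation (S \<union> T) (Lab x B)"
| RAA: "derivation S (Lab y Bot) \<Longrightarrow> derivation (S - {Lab x (Neg A)}) (Lab x A)"
| BotE: "derivation S (Lab x Bot) \<Longrightarrow> derivation S \<alpha>"
| BoxI: "derivation S (Lab y A) \<Longrightarrow> y \<noteq> x \<Longrightarrow>
    (\<And>\<gamma>. \<gamma> \<in> S - {RelU x y} \<Longrightarrow> y \<notin> labels \<gamma>) \<Longrightarrow>
    derivation (S - {RelU x y}) (Lab x (Box A))"
| BoxE: "derivation S (Lab x (Box A)) \<Longrightarrow> derivation T (RelU x y) \<Longrightarrow>
    derivation (S \<union> T) (Lab y A)"
| DotBoxI: "derivation S (Lab y A) \<Longrightarrow> y \<noteq> x \<Longrightarrow>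
    (\<And>\<gamma>. \<gamma> \<in> S - {RelP x y} \<Longrightarrow> y \<notin> labels \<gamma>) \<Longrightarrow>
    derivation (S - {RelP x y}) (Lab x (DotBox A))"
| DotBoxE: "derivation S (Lab x (DotBox A)) \<Longrightarrow> derivation T (RelP x y) \<Longrightarrow>
    derivation (S \<union> T) (Lab y A)"
| Urefl: "derivation {} (RelU x x)"
| Usymm: "derivation S (RelU x y) \<Longrightarrow> derivation S (RelU y x)"
| Utrans: "derivation S (RelU x y) \<Longrightarrow> derivation T (RelU y z) \<Longrightarrow>
    derivation (S \<union> T) (RelU x z)"
| PUI: "derivation S (RelP x y) \<Longrightarrow> derivation S (RelU x y)"
| Ptrans: "derivation S (RelP x y) \<Longrightarrow> derivation T (RelP y z) \<Longrightarrow>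
    derivation (S \<union> T) (RelP x z)"
| Class: "derivation S \<alpha> \<Longrightarrow> y \<noteq> x \<Longrightarrow> y \<notin> labels \<alpha> \<Longrightarrow>
    (\<And>\<gamma>. \<gamma> \<in> S - {RelP x y, RelP y y} \<Longrightarrow> y \<notin> labels \<gamma>) \<Longrightarrow>
    derivation (S - {RelP x y, RelP y y}) \<alpha>"
| Psub1: "derivation S \<alpha> \<Longrightarrow> x \<in> labels \<alpha> \<Longrightarrow> derivation T (RelP x x) \<Longrightarrow>
    derivation R (RelP x y) \<Longrightarrow> derivation (S \<union> T \<union> R) (subst \<alpha> y x)"
| Psub2: "derivation S \<alpha> \<Longrightarrow> y \<in> labels \<alpha> \<Longrightarrow> derivation T (RelP x x) \<Longrightarrow>
    derivation R (RelP x y) \<Longrightarrow> derivation (S \<union> T \<union> R) (subst \<alpha> x y)"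

definition derivable :: "fm set \<Rightarrow> fm \<Rightarrow> bool" where
  "derivable \<Gamma> \<alpha> \<longleftrightarrow> (\<exists>S. finite S \<and> S \<subseteq> \<Gamma> \<and> derivation S \<alpha>)"


section \<open>Semantics\<close>

record 'w model =
  worlds :: "'w set"
  relU :: "('w \<times> 'w) set"
  relP :: "('w \<times> 'w) set"
  val :: "'w \<Rightarrow> prop_symbol set"

definition is_frame :: "'w set \<Rightarrow> ('w \<times> 'w) set \<Rightarrow> ('w \<times> 'w) set \<Rightarrow> bool" where
  "is_frame W U P \<longleftrightarrow>
     W \<noteq> {} \<and> equiv W U \<and> P \<subseteq> W \<times> W \<and>
     (\<forall>v w. (v, w) \<in> P \<longrightarrow> (v, w) \<in> U) \<and>
     (\<forall>v w' w''. (v, w') \<in> P \<and> (w', w'') \<in> P \<longrightarrow> (v, w'') \<in> P) \<and>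
     (\<forall>v\<in>W. \<exists>w\<in>W. (v, w) \<in> P \<and> (w, w) \<in> P) \<and>
     (\<forall>v w. (v, v) \<in> P \<and> (v, w) \<in> P \<longrightarrow> v = w)"

definition is_model :: "'w model \<Rightarrow> bool" where
  "is_model M \<longleftrightarrow> is_frame (worlds M) (relU M) (relP M)"

primrec true_at :: "'w model \<Rightarrow> 'w \<Rightarrow> mfm \<Rightarrow> bool" where
  "true_at M w Bot \<longleftrightarrow> False"
| "true_at M w (Atom r) \<longleftrightarrow> r \<in> val M w"
| "true_at M w (Imp A B) \<longleftrightarrow> (true_at M w A \<longrightarrow> true_at M w B)"
| "true_at M w (Box A) \<longleftrightarrow> (\<forall>w'. (w, w') \<in> relU M \<longrightarrow> true_at M w' A)"
| "true_at M w (DotBox A) \<longleftrightarrow> (\<forall>w'. (w, w') \<in> relP M \<longrightarrow> true_at M w' A)"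

definition is_interpretation :: "'w model \<Rightarrow> (label \<Rightarrow> 'w) \<Rightarrow> bool" where
  "is_interpretation M I \<longleftrightarrow> (\<forall>x. I x \<in> worlds M)"

primrec satisfies :: "'w model \<Rightarrow> (label \<Rightarrow> 'w) \<Rightarrow> fm \<Rightarrow> bool" where
  "satisfies M I (RelU x y) \<longleftrightarrow> (I x, I y) \<in> relU M"
| "satisfies M I (RelP x y) \<longleftrightarrow> (I x, I y) \<in> relP M"
| "satisfies M I (Lab x A) \<longleftrightarrow> true_at M (I x) A"

text \<open>
  HOL cannot quantify over all types inside a formula, so consequence is indexed by the type
  \<open>'w\<close> from which worlds are drawn; the set of worlds is an arbitrary nonempty subset of it.
  For infinite \<open>'w\<close> this covers all finite and countable models up to isomorphism, and leaving
  the type variable \<open>'w\<close> free in a theorem makes it apply to models over every infinite type.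
\<close>

definition entails :: "'w itself \<Rightarrow> fm set \<Rightarrow> fm \<Rightarrow> bool" where
  "entails (_ :: 'w itself) \<Gamma> \<alpha> \<longleftrightarrow>
     (\<forall>(M :: 'w model) I. is_model M \<and> is_interpretation M I \<and> (\<forall>\<gamma>\<in>\<Gamma>. satisfies M I \<gamma>) \<longrightarrow>
        satisfies M I \<alpha>)"

end

theory Submission
  imports Defs "HOL-Library.Countable"
begin

text \<open>
  Completeness is by a Henkin construction on labels. Since relational formulas cannot be
  negated, the formula to be refuted is kept underivable throughout; this rests on a
  conservativity property: a consistent set derives a relational formula only if its relational
  part does. The canonical model has the derivable relations, with labels \<open>x\<close>, \<open>y\<close>
  identified when \<open>x P x\<close> and \<open>x P y\<close> are derivable. As \<open>\<Gamma>\<close> may use every label, it is first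
  renamed along \<open>x \<mapsto> 2x\<close> to make room for witnesses.
\<close>

section \<open>Soundness\<close>

text \<open>The usual Henkin step, adding one of \<open>Lab x A\<close> and
  \<open>Lab x (Neg A)\<close>, would need a case split whose conclusion is the refuted formula. For
  a relational formula no rule provides it: \<open>RAA\<close> concludes labelled formulas only.
  Conservativity repairs this. If a labelled addition makes a relational formula derivable, it has
  created a contradiction, and two contradictions can be combined by \<open>RAA\<close>. The
  property holds because \<open>BotE\<close> is the only rule leading from a labelled premise to a
  relational conclusion. A labelled goal \<open>Lab x A\<close> reduces to the goal
  \<open>Lab x Bot\<close> with \<open>Lab x (Neg A)\<close> added to the assumptions.\<close>

lemma satisfies_cong:
  "(\<And>z. z \<in> labels \<gamma> \<Longrightarrow> I z = J z) \<Longrightarrow> satisfies M I \<gamma> = satisfies M J \<gamma>"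
  by (cases \<gamma>) auto

lemma satisfies_subst:
  "I x = I y \<Longrightarrow> satisfies M I (subst \<gamma> y x) = satisfies M I \<gamma>"
  by (cases \<gamma>) auto

lemma soundness:
  fixes M :: "'w model"
  assumes "derivation S \<alpha>" "is_model M" "is_interpretation M I"
    and "\<And>\<gamma>. \<gamma> \<in> S \<Longrightarrow> satisfies M I \<gamma>"
  shows "satisfies M I \<alpha>"
  using assms(1,3,4)
proof (induction arbitrary: I rule: derivation.induct)
  have E: "equiv (worlds M) (relU M)"
    and P: "relP M \<subseteq> worlds M \<times> worlds M" "\<And>v w. (v, w) \<in> relP M \<Longrightarrow> (v, w) \<in> relU M"
      "\<And>u v w. (u, v) \<in> relP M \<Longrightarrow> (v, w) \<in> relP M \<Longrightarrow> (u, w) \<in> relP M"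
      "\<And>v. v \<in> worlds M \<Longrightarrow> \<exists>w\<in>worlds M. (v, w) \<in> relP M \<and> (w, w) \<in> relP M"
      "\<And>v w. (v, v) \<in> relP M \<Longrightarrow> (v, w) \<in> relP M \<Longrightarrow> v = w"
    using assms(2) unfolding is_model_def is_frame_def by blast+
  have U: "relU M \<subseteq> worlds M \<times> worlds M" "\<And>v. v \<in> worlds M \<Longrightarrow> (v, v) \<in> relU M"
      "\<And>v w. (v, w) \<in> relU M \<Longrightarrow> (w, v) \<in> relU M"
      "\<And>u v w. (u, v) \<in> relU M \<Longrightarrow> (v, w) \<in> relU M \<Longrightarrow> (u, w) \<in> relU M"
    using E unfolding equiv_def by (auto dest: refl_onD symD transD)
  {
    case (Assm \<alpha>)
    then show ?case by simp
  next
    case (ImpI S x B A)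
    then show ?case by fastforce
  next
    case (ImpE S x A B T)
    then show ?case by (metis UnCI satisfies.simps(3) true_at.simps(3))
  next
    case (RAA S y x A)
    then show ?case by (metis DiffI singletonD satisfies.simps(3) true_at.simps(1,3))
  next
    case (BotE S x \<alpha>)
    then show ?case by fastforce
  next
    case (BoxI S y A x)
    have "true_at M w A" if w: "(I x, w) \<in> relU M" for w
    proof -
      let ?J = "I(y := w)"
      have "satisfies M ?J \<gamma>" if "\<gamma> \<in> S" for \<gamma>
      proof (cases "\<gamma> = RelU x y")
        case True
        then show ?thesis using w BoxI.hyps by simp
      next
        case False
        then have "satisfies M I \<gamma>" "y \<notin> labels \<gamma>"
          using BoxI.prems BoxI.hyps that by blast+
        then show ?thesis by (metis fun_upd_other satisfies_cong)
      qed
      moreover have "is_interpretation M ?J"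
        using BoxI.prems(1) U(1) w by (auto simp: is_interpretation_def)
      ultimately have "satisfies M ?J (Lab y A)" by (intro BoxI.IH)
      then show ?thesis by simp
    qed
    then show ?case by simp
  next
    case (BoxE S x A T y)
    then have "satisfies M I (Lab x (Box A))" "satisfies M I (RelU x y)" by simp_all
    then show ?case by simp
  next
    case (DotBoxI S y A x)
    have "true_at M w A" if w: "(I x, w) \<in> relP M" for w
    proof -
      let ?J = "I(y := w)"
      have "satisfies M ?J \<gamma>" if "\<gamma> \<in> S" for \<gamma>
      proof (cases "\<gamma> = RelP x y")
        case True
        then show ?thesis using w DotBoxI.hyps by simp
      next
        case False
        then have "satisfies M I \<gamma>" "y \<notin> labels \<gamma>"
          using DotBoxI.prems DotBoxI.hyps that by blast+
        then show ?thesis by (metis fun_upd_other satisfies_cong)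
      qed
      moreover have "is_interpretation M ?J"
        using DotBoxI.prems(1) P(1) w by (auto simp: is_interpretation_def)
      ultimately have "satisfies M ?J (Lab y A)" by (intro DotBoxI.IH)
      then show ?thesis by simp
    qed
    then show ?case by simp
  next
    case (DotBoxE S x A T y)
    then have "satisfies M I (Lab x (DotBox A))" "satisfies M I (RelP x y)" by simp_all
    then show ?case by simp
  next
    case (Urefl x)
    then show ?case using U(2) by (simp add: is_interpretation_def)
  next
    case (Usymm S x y)
    then show ?case using U(3) by simp
  next
    case (Utrans S x y T z)
    then have "satisfies M I (RelU x y)" "satisfies M I (RelU y z)" by simp_all
    then show ?case using U(4) by simp
  next
    case (PUI S x y)
    then show ?case using P(2) by simp
  next
    case (Ptrans S x y T z)
    then have "satisfies M I (RelP x y)" "satisfies M I (RelP y z)" by simp_all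
    then show ?case using P(3) by simp
  next
    case (Class S \<alpha> y x)
    obtain w where w: "w \<in> worlds M" "(I x, w) \<in> relP M" "(w, w) \<in> relP M"
      using P(4)[of "I x"] Class.prems(1) by (auto simp: is_interpretation_def)
    let ?J = "I(y := w)"
    have "satisfies M ?J \<gamma>" if "\<gamma> \<in> S" for \<gamma>
    proof (cases "\<gamma> \<in> {RelP x y, RelP y y}")
      case True
      then show ?thesis using w Class.hyps by auto
    next
      case False
      then have "satisfies M I \<gamma>" "y \<notin> labels \<gamma>"
        using Class.prems Class.hyps that by blast+
      then show ?thesis by (metis fun_upd_other satisfies_cong)
    qed
    moreover have "is_interpretation M ?J"
      using Class.prems(1) w by (auto simp: is_interpretation_def)
    ultimately have "satisfies M ?J \<alpha>" by (intro Class.IH)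
    then show ?case using \<open>y \<notin> labels \<alpha>\<close> by (metis fun_upd_other satisfies_cong)
  next
    case (Psub1 S \<alpha> x T R y)
    then have "satisfies M I \<alpha>" "satisfies M I (RelP x x)" "satisfies M I (RelP x y)" by simp_all
    then show ?case using P(5) satisfies_subst by (metis satisfies.simps(2))
  next
    case (Psub2 S \<alpha> y T x R)
    then have "satisfies M I \<alpha>" "satisfies M I (RelP x x)" "satisfies M I (RelP x y)" by simp_all
    then show ?case using P(5) satisfies_subst by (metis satisfies.simps(2))
  }
qed


section \<open>Derivability from a set of assumptions\<close>

lemma finite_labels [simp]: "finite (labels \<alpha>)"
  by (cases \<alpha>) auto

lemma derivation_finite: "derivation S \<alpha> \<Longrightarrow> finite S"
  by (induction rule: derivation.induct) auto

lemma derivableI: "derivation S \<alpha> \<Longrightarrow> S \<subseteq> \<Gamma> \<Longrightarrow> derivable \<Gamma> \<alpha>"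
  unfolding derivable_def using derivation_finite by blast

lemma derivableE:
  assumes "derivable \<Gamma> \<alpha>"
  obtains S where "finite S" "S \<subseteq> \<Gamma>" "derivation S \<alpha>"
  using assms unfolding derivable_def by blast

lemma derivable_mono: "derivable \<Gamma> \<alpha> \<Longrightarrow> \<Gamma> \<subseteq> \<Delta> \<Longrightarrow> derivable \<Delta> \<alpha>"
  unfolding derivable_def by blast

lemma derivable_assm: "\<alpha> \<in> \<Gamma> \<Longrightarrow> derivable \<Gamma> \<alpha>"
  by (rule derivableI[OF Assm]) simp

text \<open>The rules are restated over a common context: \<open>derivation\<close> tracks exact
  assumption sets, and \<open>derivable\<close> absorbs the unions and differences this
  causes.\<close>

lemma derivable_ImpI:
  "derivable (insert (Lab x A) \<Gamma>) (Lab x B) \<Longrightarrow> derivable \<Gamma> (Lab x (Imp A B))"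
  by (elim derivableE) (rule derivableI[OF ImpI], auto)

lemma derivable_ImpE:
  "derivable \<Gamma> (Lab x (Imp A B)) \<Longrightarrow> derivable \<Gamma> (Lab x A) \<Longrightarrow> derivable \<Gamma> (Lab x B)"
  by (elim derivableE) (rule derivableI[OF ImpE], assumption, assumption, blast)

lemma derivable_RAA:
  "derivable (insert (Lab x (Neg A)) \<Gamma>) (Lab y Bot) \<Longrightarrow> derivable \<Gamma> (Lab x A)"
  by (elim derivableE) (rule derivableI[OF RAA], auto)

lemma derivable_BotE: "derivable \<Gamma> (Lab x Bot) \<Longrightarrow> derivable \<Gamma> \<alpha>"
  by (elim derivableE) (rule derivableI[OF BotE], auto)

lemma derivable_BoxI:
  assumes "derivable (insert (RelU x y) \<Gamma>) (Lab y A)" "y \<noteq> x" "\<And>\<gamma>. \<gamma> \<in> \<Gamma> \<Longrightarrow> y \<notin> labels \<gamma>"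
  shows "derivable \<Gamma> (Lab x (Box A))"
  using assms(1) by (rule derivableE) (rule derivableI[OF BoxI], use assms in auto)

lemma derivable_DotBoxI:
  assumes "derivable (insert (RelP x y) \<Gamma>) (Lab y A)" "y \<noteq> x" "\<And>\<gamma>. \<gamma> \<in> \<Gamma> \<Longrightarrow> y \<notin> labels \<gamma>"
  shows "derivable \<Gamma> (Lab x (DotBox A))"
  using assms(1) by (rule derivableE) (rule derivableI[OF DotBoxI], use assms in auto)

lemma derivable_BoxE:
  "derivable \<Gamma> (Lab x (Box A)) \<Longrightarrow> derivable \<Gamma> (RelU x y) \<Longrightarrow> derivable \<Gamma> (Lab y A)"
  by (elim derivableE) (rule derivableI[OF BoxE], assumption, assumption, blast)

lemma derivable_DotBoxE:
  "derivable \<Gamma> (Lab x (DotBox A)) \<Longrightarrow> derivable \<Gamma> (RelP x y) \<Longrightarrow> derivable \<Gamma> (Lab y A)"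
  by (elim derivableE) (rule derivableI[OF DotBoxE], assumption, assumption, blast)

lemma derivable_Urefl: "derivable \<Gamma> (RelU x x)"
  by (rule derivableI[OF Urefl]) simp

lemma derivable_Usymm: "derivable \<Gamma> (RelU x y) \<Longrightarrow> derivable \<Gamma> (RelU y x)"
  by (elim derivableE) (rule derivableI[OF Usymm], auto)

lemma derivable_Utrans:
  "derivable \<Gamma> (RelU x y) \<Longrightarrow> derivable \<Gamma> (RelU y z) \<Longrightarrow> derivable \<Gamma> (RelU x z)"
  by (elim derivableE) (rule derivableI[OF Utrans], assumption, assumption, blast)

lemma derivable_PUI: "derivable \<Gamma> (RelP x y) \<Longrightarrow> derivable \<Gamma> (RelU x y)"
  by (elim derivableE) (rule derivableI[OF PUI], auto)

lemma derivable_Ptrans: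
  "derivable \<Gamma> (RelP x y) \<Longrightarrow> derivable \<Gamma> (RelP y z) \<Longrightarrow> derivable \<Gamma> (RelP x z)"
  by (elim derivableE) (rule derivableI[OF Ptrans], assumption, assumption, blast)

lemma derivable_Class:
  assumes "derivable (insert (RelP x y) (insert (RelP y y) \<Gamma>)) \<alpha>" "y \<noteq> x" "y \<notin> labels \<alpha>"
    "\<And>\<gamma>. \<gamma> \<in> \<Gamma> \<Longrightarrow> y \<notin> labels \<gamma>"
  shows "derivable \<Gamma> \<alpha>"
  using assms(1) by (rule derivableE) (rule derivableI[OF Class], use assms in auto)

lemma derivable_Psub1:
  "derivable \<Gamma> \<alpha> \<Longrightarrow> x \<in> labels \<alpha> \<Longrightarrow> derivable \<Gamma> (RelP x x) \<Longrightarrow> derivable \<Gamma> (RelP x y) \<Longrightarrow>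
    derivable \<Gamma> (subst \<alpha> y x)"
  by (elim derivableE) (rule derivableI[OF Psub1], assumption, assumption, assumption, assumption, blast)

lemma derivable_Psub2:
  "derivable \<Gamma> \<alpha> \<Longrightarrow> y \<in> labels \<alpha> \<Longrightarrow> derivable \<Gamma> (RelP x x) \<Longrightarrow> derivable \<Gamma> (RelP x y) \<Longrightarrow>
    derivable \<Gamma> (subst \<alpha> x y)"
  by (elim derivableE) (rule derivableI[OF Psub2], assumption, assumption, assumption, assumption, blast)

text \<open>The context versions of the eigenvariable rules ask for a label fresh for the whole
  context. A finite context always leaves one, so several arguments below first pass to finitely
  many assumptions.\<close>

lemma ex_fresh:
  assumes "finite \<Gamma>" "finite (X :: label set)"
  obtains z where "z \<notin> X" "\<And>\<gamma>. \<gamma> \<in> \<Gamma> \<Longrightarrow> z \<notin> labels \<gamma>"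
proof -
  have "finite (X \<union> (\<Union>\<gamma>\<in>\<Gamma>. labels \<gamma>))" using assms by simp
  from ex_new_if_finite[OF infinite_UNIV_nat this] show ?thesis using that by blast
qed

text \<open>
  The substitution rules replace all occurrences of a label, so they do not turn \<open>x P x\<close> into
  \<open>y P x\<close>. Instead take \<open>z\<close> with \<open>y P z\<close> from \<open>class\<close>; then \<open>x P z\<close>, and \<open>z\<close> may be
  replaced by \<open>x\<close> in \<open>y P z\<close>.
\<close>

lemma derivable_Psymm:
  assumes xx: "derivable \<Gamma> (RelP x x)" and xy: "derivable \<Gamma> (RelP x y)"
  shows "derivable \<Gamma> (RelP y x)"
proof -
  from xx obtain S where S: "finite S" "S \<subseteq> \<Gamma>" "derivation S (RelP x x)" by (rule derivableE)
  from xy obtain T where T: "finite T" "T \<subseteq> \<Gamma>" "derivation T (RelP x y)" by (rule derivableE)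
  obtain z where z: "z \<notin> {x, y}" "\<And>\<gamma>. \<gamma> \<in> S \<union> T \<Longrightarrow> z \<notin> labels \<gamma>"
    using ex_fresh[of "S \<union> T" "{x, y}"] S T by (metis finite.emptyI finite_UnI finite_insert)
  let ?\<Delta> = "insert (RelP y z) (insert (RelP z z) (S \<union> T))"
  have yz: "derivable ?\<Delta> (RelP y z)" by (rule derivable_assm) simp
  have xx': "derivable ?\<Delta> (RelP x x)" by (rule derivableI[OF S(3)]) auto
  have "derivable ?\<Delta> (RelP x y)" by (rule derivableI[OF T(3)]) auto
  then have "derivable ?\<Delta> (RelP x z)" using yz by (rule derivable_Ptrans)
  from derivable_Psub2[OF yz _ xx' this] have "derivable ?\<Delta> (RelP y x)" using z by auto
  then have "derivable (S \<union> T) (RelP y x)" by (rule derivable_Class) (use z in auto)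
  then show ?thesis by (rule derivable_mono) (use S T in auto)
qed


section \<open>Renaming and cut\<close>

primrec rename :: "(label \<Rightarrow> label) \<Rightarrow> fm \<Rightarrow> fm" where
  "rename f (RelU x y) = RelU (f x) (f y)"
| "rename f (RelP x y) = RelP (f x) (f y)"
| "rename f (Lab x A) = Lab (f x) A"

lemma rename_cong: "(\<And>z. z \<in> labels \<gamma> \<Longrightarrow> f z = g z) \<Longrightarrow> rename f \<gamma> = rename g \<gamma>"
  by (cases \<gamma>) auto

lemma rename_upd [simp]: "y \<notin> labels \<gamma> \<Longrightarrow> rename (f(y := z)) \<gamma> = rename f \<gamma>"
  by (rule rename_cong) auto

lemma rename_id [simp]: "rename id \<gamma> = \<gamma>"
  by (cases \<gamma>) simp_all

lemma rename_rename: "rename f (rename g \<gamma>) = rename (f \<circ> g) \<gamma>"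
  by (cases \<gamma>) auto

lemma labels_rename: "labels (rename f \<gamma>) = f ` labels \<gamma>"
  by (cases \<gamma>) auto

lemma satisfies_rename: "satisfies M I (rename f \<gamma>) = satisfies M (I \<circ> f) \<gamma>"
  by (cases \<gamma>) auto

text \<open>A non-injective \<open>f\<close> does not commute with \<open>subst\<close>: it may
  merge \<open>u\<close> with another label of \<open>\<alpha>\<close>, and a substitution rule
  would then replace too much. In relational formulas the wanted ends are therefore moved one by one
  by transitivity, which takes both directions between \<open>f u\<close> and \<open>f v\<close>. A
  labelled formula has a single label, so \<open>Psub1\<close> is exact there.\<close>

lemma derivable_rename_subst:
  assumes "derivable \<Gamma> (rename f \<alpha>)"
    and uv: "derivable \<Gamma> (RelP (f u) (f v))" and vu: "derivable \<Gamma> (RelP (f v) (f u))"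
  shows "derivable \<Gamma> (rename f (subst \<alpha> v u))"
proof (cases \<alpha>)
  case (RelU a b)
  have "derivable \<Gamma> (RelU (f u) (f v))" "derivable \<Gamma> (RelU (f v) (f u))"
    using uv vu by (auto intro: derivable_PUI)
  then show ?thesis using assms(1) RelU by (auto intro: derivable_Utrans)
next
  case (RelP a b)
  then show ?thesis using assms by (auto intro: derivable_Ptrans)
next
  case (Lab a A)
  have "derivable \<Gamma> (RelP (f u) (f u))" using uv vu by (rule derivable_Ptrans)
  from derivable_Psub1[OF _ _ this uv, of "Lab (f u) A"] show ?thesis
    using assms(1) Lab by auto
qed

text \<open>
  Renaming along an arbitrary map and cut are proved together: under an eigenvariable rule the
  map is redirected at the eigenvariable to a label that is fresh for \<open>\<Delta>\<close>.
\<close>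

lemma derivation_rename_cut:
  assumes "derivation S \<alpha>" "finite \<Delta>" "\<And>\<gamma>. \<gamma> \<in> S \<Longrightarrow> derivable \<Delta> (rename f \<gamma>)"
  shows "derivable \<Delta> (rename f \<alpha>)"
  using assms
proof (induction arbitrary: f \<Delta> rule: derivation.induct)
  case (Assm \<alpha>)
  then show ?case by simp
next
  case (ImpI S x B A)
  have "derivable (insert (Lab (f x) A) \<Delta>) (rename f (Lab x B))"
  proof (rule ImpI.IH)
    fix \<gamma> assume "\<gamma> \<in> S"
    then show "derivable (insert (Lab (f x) A) \<Delta>) (rename f \<gamma>)"
      using ImpI.prems(2)[of \<gamma>]
      by (cases "\<gamma> = Lab x A") (auto intro: derivable_assm derivable_mono)
  qed (use ImpI in auto)
  then show ?case by (auto intro: derivable_ImpI)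
next
  case (ImpE S x A B T)
  then have "derivable \<Delta> (rename f (Lab x (Imp A B)))" "derivable \<Delta> (rename f (Lab x A))" by blast+
  then show ?case by (auto intro: derivable_ImpE)
next
  case (RAA S y x A)
  have "derivable (insert (Lab (f x) (Neg A)) \<Delta>) (rename f (Lab y Bot))"
  proof (rule RAA.IH)
    fix \<gamma> assume "\<gamma> \<in> S"
    then show "derivable (insert (Lab (f x) (Neg A)) \<Delta>) (rename f \<gamma>)"
      using RAA.prems(2)[of \<gamma>]
      by (cases "\<gamma> = Lab x (Neg A)") (auto intro: derivable_assm derivable_mono)
  qed (use RAA in auto)
  then show ?case by (auto intro: derivable_RAA)
next
  case (BotE S x \<alpha>)
  then have "derivable \<Delta> (rename f (Lab x Bot))" by blast
  then show ?case by (auto intro: derivable_BotE)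
next
  case (BoxI S y A x)
  obtain z where z: "z \<notin> {f x}" "\<And>\<gamma>. \<gamma> \<in> \<Delta> \<Longrightarrow> z \<notin> labels \<gamma>"
    using ex_fresh[OF \<open>finite \<Delta>\<close>] by (metis finite.emptyI finite_insert)
  have "derivable (insert (RelU (f x) z) \<Delta>) (rename (f(y := z)) (Lab y A))"
  proof (rule BoxI.IH)
    fix \<gamma> assume "\<gamma> \<in> S"
    then show "derivable (insert (RelU (f x) z) \<Delta>) (rename (f(y := z)) \<gamma>)"
      using BoxI.prems(2)[of \<gamma>] BoxI.hyps(2,3)
      by (cases "\<gamma> = RelU x y") (auto intro: derivable_assm derivable_mono)
  qed (use BoxI in auto)
  then show ?case using z by (auto intro: derivable_BoxI)
next
  case (BoxE S x A T y)
  then have "derivable \<Delta> (rename f (Lab x (Box A)))" "derivable \<Delta> (rename f (RelU x y))" by blast+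
  then show ?case by (auto intro: derivable_BoxE)
next
  case (DotBoxI S y A x)
  obtain z where z: "z \<notin> {f x}" "\<And>\<gamma>. \<gamma> \<in> \<Delta> \<Longrightarrow> z \<notin> labels \<gamma>"
    using ex_fresh[OF \<open>finite \<Delta>\<close>] by (metis finite.emptyI finite_insert)
  have "derivable (insert (RelP (f x) z) \<Delta>) (rename (f(y := z)) (Lab y A))"
  proof (rule DotBoxI.IH)
    fix \<gamma> assume "\<gamma> \<in> S"
    then show "derivable (insert (RelP (f x) z) \<Delta>) (rename (f(y := z)) \<gamma>)"
      using DotBoxI.prems(2)[of \<gamma>] DotBoxI.hyps(2,3)
      by (cases "\<gamma> = RelP x y") (auto intro: derivable_assm derivable_mono)
  qed (use DotBoxI in auto)
  then show ?case using z by (auto intro: derivable_DotBoxI)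
next
  case (DotBoxE S x A T y)
  then have "derivable \<Delta> (rename f (Lab x (DotBox A)))" "derivable \<Delta> (rename f (RelP x y))" by blast+
  then show ?case by (auto intro: derivable_DotBoxE)
next
  case (Urefl x)
  then show ?case by (simp add: derivable_Urefl)
next
  case (Usymm S x y)
  then have "derivable \<Delta> (rename f (RelU x y))" by blast
  then show ?case by (auto intro: derivable_Usymm)
next
  case (Utrans S x y T z)
  then have "derivable \<Delta> (rename f (RelU x y))" "derivable \<Delta> (rename f (RelU y z))" by blast+
  then show ?case by (auto intro: derivable_Utrans)
next
  case (PUI S x y)
  then have "derivable \<Delta> (rename f (RelP x y))" by blast
  then show ?case by (auto intro: derivable_PUI)
next
  case (Ptrans S x y T z)
  then have "derivable \<Delta> (rename f (RelP x y))" "derivable \<Delta> (rename f (RelP y z))" by blast+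
  then show ?case by (auto intro: derivable_Ptrans)
next
  case (Class S \<alpha> y x)
  \<comment> \<open>Unlike for the box rules, the conclusion survives the discharge unchanged, so
    \<open>z\<close> must avoid its labels too.\<close>
  obtain z where z: "z \<notin> insert (f x) (labels (rename f \<alpha>))" "\<And>\<gamma>. \<gamma> \<in> \<Delta> \<Longrightarrow> z \<notin> labels \<gamma>"
    using ex_fresh[OF \<open>finite \<Delta>\<close>] by (metis finite_labels finite_insert)
  let ?\<Delta> = "insert (RelP (f x) z) (insert (RelP z z) \<Delta>)"
  have "derivable ?\<Delta> (rename (f(y := z)) \<alpha>)"
  proof (rule Class.IH)
    fix \<gamma> assume g: "\<gamma> \<in> S"
    show "derivable ?\<Delta> (rename (f(y := z)) \<gamma>)"
    proof (cases "\<gamma> \<in> {RelP x y, RelP y y}")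
      case True
      then show ?thesis using Class.hyps(2) by (auto intro: derivable_assm)
    next
      case False
      then have "y \<notin> labels \<gamma>" "derivable \<Delta> (rename f \<gamma>)"
        using Class.hyps Class.prems g by blast+
      then show ?thesis by (auto intro: derivable_mono)
    qed
  qed (use Class in auto)
  then have "derivable ?\<Delta> (rename f \<alpha>)" using Class.hyps(3) by simp
  then show ?case by (rule derivable_Class) (use z in auto)
next
  case (Psub1 S \<alpha> x T R y)
  have xx: "derivable \<Delta> (RelP (f x) (f x))" and xy: "derivable \<Delta> (RelP (f x) (f y))"
    using Psub1.IH(2,3)[of \<Delta> f] Psub1.prems by simp_all
  show ?case
    \<comment> \<open>The rule supplies only one direction; the converse is
      \<open>derivable_Psymm\<close>.\<close>
    by (rule derivable_rename_subst[where u = x and v = y, OF _ xy derivable_Psymm[OF xx xy]])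
      (use Psub1.IH(1)[of \<Delta> f] Psub1.prems in simp)
next
  case (Psub2 S \<alpha> y T x R)
  have xx: "derivable \<Delta> (RelP (f x) (f x))" and xy: "derivable \<Delta> (RelP (f x) (f y))"
    using Psub2.IH(2,3)[of \<Delta> f] Psub2.prems by simp_all
  show ?case
    by (rule derivable_rename_subst[where u = y and v = x, OF _ derivable_Psymm[OF xx xy] xy])
      (use Psub2.IH(1)[of \<Delta> f] Psub2.prems in simp)
qed

text \<open>Each of the finitely many open assumptions needs only a finite part of
  \<open>\<Delta>\<close>; the union of these parts is a finite context, to which the previous lemma
  applies.\<close>

lemma derivable_rename_cut:
  assumes "derivable \<Gamma> \<alpha>" "\<And>\<gamma>. \<gamma> \<in> \<Gamma> \<Longrightarrow> derivable \<Delta> (rename f \<gamma>)"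
  shows "derivable \<Delta> (rename f \<alpha>)"
proof -
  from assms(1) obtain S where S: "finite S" "S \<subseteq> \<Gamma>" "derivation S \<alpha>" by (rule derivableE)
  have "\<forall>\<gamma>\<in>S. \<exists>T. finite T \<and> T \<subseteq> \<Delta> \<and> derivation T (rename f \<gamma>)"
    using assms(2) S(2) unfolding derivable_def by blast
  then obtain T where T: "\<And>\<gamma>. \<gamma> \<in> S \<Longrightarrow> finite (T \<gamma>) \<and> T \<gamma> \<subseteq> \<Delta> \<and> derivation (T \<gamma>) (rename f \<gamma>)"
    by metis
  have "derivable (\<Union>\<gamma>\<in>S. T \<gamma>) (rename f \<alpha>)"
  proof (rule derivation_rename_cut[OF S(3)])
    show "derivable (\<Union>\<gamma>\<in>S. T \<gamma>) (rename f \<gamma>)" if "\<gamma> \<in> S" for \<gamma>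
      using T[OF that] that by (auto intro: derivableI)
  qed (use S T in auto)
  then show ?thesis by (rule derivable_mono) (use T in auto)
qed

text \<open>Renaming back along a left inverse of \<open>f\<close>. Read contrapositively,
  underivability passes to the renamed copy.\<close>

lemma derivable_rename_inj:
  assumes "derivable (rename f ` \<Gamma>) (rename f \<alpha>)" "inj f"
  shows "derivable \<Gamma> \<alpha>"
proof -
  have *: "rename (inv f) (rename f \<gamma>) = \<gamma>" for \<gamma>
    using \<open>inj f\<close> by (simp add: rename_rename)
  have "derivable \<Gamma> (rename (inv f) (rename f \<alpha>))"
    by (rule derivable_rename_cut[OF assms(1)]) (auto simp: * intro: derivable_assm)
  then show ?thesis by (simp only: *)
qed

text \<open>Only \<open>BoxI\<close> discharges \<open>RelU x y\<close>, and its conclusion is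
  boxed. For other conclusions the fresh \<open>y\<close> is renamed to \<open>x\<close>, which
  turns the assumption into an instance of \<open>Urefl\<close>.\<close>

lemma derivable_fresh_U:
  assumes "derivable (insert (RelU x y) \<Gamma>) \<alpha>" "y \<notin> labels \<alpha>" "y \<noteq> x" "\<And>\<gamma>. \<gamma> \<in> \<Gamma> \<Longrightarrow> y \<notin> labels \<gamma>"
  shows "derivable \<Gamma> \<alpha>"
proof -
  have "derivable \<Gamma> (rename (id(y := x)) \<alpha>)"
    by (rule derivable_rename_cut[OF assms(1)])
      (use assms in \<open>auto intro: derivable_assm derivable_Urefl\<close>)
  then show ?thesis using assms(2) by simp
qed


section \<open>Conservativity over relational formulas\<close>

primrec is_rel :: "fm \<Rightarrow> bool" where
  "is_rel (RelU x y) \<longleftrightarrow> True"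
| "is_rel (RelP x y) \<longleftrightarrow> True"
| "is_rel (Lab x A) \<longleftrightarrow> False"

definition inconsistent :: "fm set \<Rightarrow> bool" where
  "inconsistent \<Gamma> \<longleftrightarrow> (\<exists>x. derivable \<Gamma> (Lab x Bot))"

lemma inconsistent_mono: "inconsistent \<Gamma> \<Longrightarrow> \<Gamma> \<subseteq> \<Delta> \<Longrightarrow> inconsistent \<Delta>"
  unfolding inconsistent_def by (blast intro: derivable_mono)

lemma inconsistent_derivable: "inconsistent \<Gamma> \<Longrightarrow> derivable \<Gamma> \<alpha>"
  unfolding inconsistent_def by (blast intro: derivable_BotE)

lemma is_rel_subst [simp]: "is_rel (subst \<alpha> y x) = is_rel \<alpha>"
  by (cases \<alpha>) auto

abbreviation rels :: "fm set \<Rightarrow> fm set" where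
  "rels \<Gamma> \<equiv> {\<gamma> \<in> \<Gamma>. is_rel \<gamma>}"

text \<open>Apart from \<open>BotE\<close>, every rule with a relational conclusion has only
  relational premises, and \<open>Class\<close> and the substitution rules keep the kind of their
  formula. The cases with a labelled conclusion are excluded by \<open>is_rel\<close>.\<close>

lemma rels_derivation:
  "derivation S \<alpha> \<Longrightarrow> is_rel \<alpha> \<Longrightarrow> inconsistent S \<or> derivable (rels S) \<alpha>"
proof (induction rule: derivation.induct)
  case (Assm \<alpha>)
  then show ?case by (auto intro: derivable_assm)
next
  case (BotE S x \<alpha>)
  then show ?case by (auto simp: inconsistent_def intro: derivableI)
next
  case (Urefl x)
  then show ?case by (auto intro: derivable_Urefl)
next
  case (Usymm S x y)
  then show ?case by (auto intro: derivable_Usymm)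
next
  case (Utrans S x y T z)
  show ?case
  proof (cases "inconsistent S \<or> inconsistent T")
    case True
    then show ?thesis by (blast intro: inconsistent_mono)
  next
    case False
    then have "derivable (rels (S \<union> T)) (RelU x y)" "derivable (rels (S \<union> T)) (RelU y z)"
      using Utrans.IH by (auto elim!: derivable_mono)
    then show ?thesis by (blast intro: derivable_Utrans)
  qed
next
  case (PUI S x y)
  then show ?case by (auto intro: derivable_PUI)
next
  case (Ptrans S x y T z)
  show ?case
  proof (cases "inconsistent S \<or> inconsistent T")
    case True
    then show ?thesis by (blast intro: inconsistent_mono)
  next
    case False
    then have "derivable (rels (S \<union> T)) (RelP x y)" "derivable (rels (S \<union> T)) (RelP y z)"
      using Ptrans.IH by (auto elim!: derivable_mono)
    then show ?thesis by (blast intro: derivable_Ptrans)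
  qed
next
  case (Class S \<alpha> y x)
  let ?S = "S - {RelP x y, RelP y y}"
  show ?case
  proof (cases "inconsistent S")
    case True
    \<comment> \<open>The contradiction is placed at \<open>x\<close>, which differs from the
      eigenvariable \<open>y\<close>, so that \<open>Class\<close> can discharge and the remaining
      assumptions are already inconsistent.\<close>
    then have "derivable S (Lab x Bot)" by (rule inconsistent_derivable)
    then have "derivable (insert (RelP x y) (insert (RelP y y) ?S)) (Lab x Bot)"
      by (rule derivable_mono) auto
    then have "derivable ?S (Lab x Bot)"
      by (rule derivable_Class) (use Class.hyps in auto)
    then show ?thesis unfolding inconsistent_def by blast
  next
    case False
    then have "derivable (rels S) \<alpha>" using Class by blast
    then have "derivable (insert (RelP x y) (insert (RelP y y) (rels ?S))) \<alpha>"
      by (rule derivable_mono) auto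
    then have "derivable (rels ?S) \<alpha>"
      by (rule derivable_Class) (use Class.hyps in auto)
    then show ?thesis by blast
  qed
next
  case (Psub1 S \<alpha> x T R y)
  show ?case
  proof (cases "inconsistent S \<or> inconsistent T \<or> inconsistent R")
    case True
    then show ?thesis by (blast intro: inconsistent_mono)
  next
    case False
    let ?R = "rels (S \<union> T \<union> R)"
    have "derivable ?R \<alpha>" "derivable ?R (RelP x x)" "derivable ?R (RelP x y)"
      using False Psub1.IH Psub1.prems by (auto elim!: derivable_mono)
    then show ?thesis using Psub1.hyps by (blast intro: derivable_Psub1)
  qed
next
  case (Psub2 S \<alpha> y T x R)
  show ?case
  proof (cases "inconsistent S \<or> inconsistent T \<or> inconsistent R")
    case True
    then show ?thesis by (blast intro: inconsistent_mono)
  next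
    case False
    let ?R = "rels (S \<union> T \<union> R)"
    have "derivable ?R \<alpha>" "derivable ?R (RelP x x)" "derivable ?R (RelP x y)"
      using False Psub2.IH Psub2.prems by (auto elim!: derivable_mono)
    then show ?thesis using Psub2.hyps by (blast intro: derivable_Psub2)
  qed
qed simp_all

text \<open>
  Relational formulas have no negation, so the Henkin construction keeps a fixed formula
  underivable instead of keeping the set consistent. Formulas \<open>x: \<bottom>\<close> are admitted as targets
  to cover labelled conclusions as well.
\<close>

definition target :: "fm \<Rightarrow> bool" where
  "target \<alpha> \<longleftrightarrow> is_rel \<alpha> \<or> (\<exists>x. \<alpha> = Lab x Bot)"

lemma target_cases:
  assumes "target \<alpha>" "derivable \<Gamma> \<alpha>"
  shows "inconsistent \<Gamma> \<or> derivable (rels \<Gamma>) \<alpha>"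
proof (cases "is_rel \<alpha>")
  case True
  from assms(2) obtain S where S: "S \<subseteq> \<Gamma>" "derivation S \<alpha>" by (rule derivableE)
  from rels_derivation[OF S(2) True] show ?thesis
  proof
    assume "inconsistent S"
    then show ?thesis using S inconsistent_mono by blast
  next
    assume "derivable (rels S) \<alpha>"
    then have "derivable (rels \<Gamma>) \<alpha>" by (rule derivable_mono) (use S in auto)
    then show ?thesis ..
  qed
next
  case False
  then show ?thesis using assms by (auto simp: target_def inconsistent_def)
qed


section \<open>Henkin extensions\<close>

text \<open>The relational part of either extension lies in \<open>\<Gamma>\<close> and so does not
  derive \<open>\<alpha>\<close>. If both extensions derived \<open>\<alpha>\<close>, both would be
  inconsistent, and \<open>ImpI\<close> with \<open>RAA\<close> would make \<open>\<Gamma>\<close>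
  inconsistent.\<close>

lemma extend_decide:
  assumes "target \<alpha>" "\<not> derivable \<Gamma> \<alpha>"
  shows "\<not> derivable (insert (Lab x A) \<Gamma>) \<alpha> \<or> \<not> derivable (insert (Lab x (Neg A)) \<Gamma>) \<alpha>"
proof (rule ccontr)
  assume "\<not> ?thesis"
  moreover have "inconsistent (insert (Lab x B) \<Gamma>)" if d: "derivable (insert (Lab x B) \<Gamma>) \<alpha>" for B
  proof -
    have "rels (insert (Lab x B) \<Gamma>) \<subseteq> \<Gamma>" by auto
    then show ?thesis using target_cases[OF assms(1) d] assms(2) derivable_mono by blast
  qed
  ultimately have *: "derivable (insert (Lab x A) \<Gamma>) (Lab x Bot)"
    "derivable (insert (Lab x (Neg A)) \<Gamma>) (Lab x Bot)"
    by (auto intro: inconsistent_derivable)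
  have "derivable \<Gamma> (Lab x Bot)"
    using derivable_ImpI[OF *(1)] derivable_RAA[OF *(2)] by (rule derivable_ImpE)
  then show False using assms(2) derivable_BotE by blast
qed

lemma extend_class:
  assumes "\<not> derivable \<Gamma> \<alpha>" "y \<noteq> x" "y \<notin> labels \<alpha>" "\<And>\<gamma>. \<gamma> \<in> \<Gamma> \<Longrightarrow> y \<notin> labels \<gamma>"
  shows "\<not> derivable (insert (RelP x y) (insert (RelP y y) \<Gamma>)) \<alpha>"
  using assms derivable_Class by blast

text \<open>A contradiction would yield \<open>Lab x (Box A)\<close> by \<open>RAA\<close> and
  \<open>BoxI\<close>, against the assumed negation. In the relational case the labelled witness
  drops out and \<open>derivable_fresh_U\<close> removes \<open>RelU x y\<close>.\<close>

lemma extend_Box: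
  assumes "target \<alpha>" "\<not> derivable \<Gamma> \<alpha>" "Lab x (Neg (Box A)) \<in> \<Gamma>"
    and y: "y \<noteq> x" "y \<notin> labels \<alpha>" "\<And>\<gamma>. \<gamma> \<in> \<Gamma> \<Longrightarrow> y \<notin> labels \<gamma>"
  shows "\<not> derivable (insert (Lab y (Neg A)) (insert (RelU x y) \<Gamma>)) \<alpha>"
proof
  assume "derivable (insert (Lab y (Neg A)) (insert (RelU x y) \<Gamma>)) \<alpha>"
  from target_cases[OF assms(1) this] show False
  proof
    assume "inconsistent (insert (Lab y (Neg A)) (insert (RelU x y) \<Gamma>))"
    then have "derivable (insert (RelU x y) \<Gamma>) (Lab y A)"
      by (rule derivable_RAA[OF inconsistent_derivable])
    then have "derivable \<Gamma> (Lab x (Box A))" using y(1,3) by (rule derivable_BoxI)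
    with derivable_assm[OF assms(3)] have "derivable \<Gamma> (Lab x Bot)" by (rule derivable_ImpE)
    then show False using assms(2) derivable_BotE by blast
  next
    assume "derivable (rels (insert (Lab y (Neg A)) (insert (RelU x y) \<Gamma>))) \<alpha>"
    then have "derivable (insert (RelU x y) \<Gamma>) \<alpha>" by (rule derivable_mono) auto
    then have "derivable \<Gamma> \<alpha>" using y(2,1,3) by (rule derivable_fresh_U)
    then show False using assms(2) by contradiction
  qed
qed

text \<open>As for \<open>Box\<close>, except that \<open>y\<close> cannot be folded into
  \<open>x\<close>, since \<open>RelP x x\<close> need not be derivable. In the relational case
  \<open>RelP y y\<close> is added by weakening and \<open>Class\<close> discharges both
  relations.\<close>

lemma extend_DotBox:
  assumes "target \<alpha>" "\<not> derivable \<Gamma> \<alpha>" "Lab x (Neg (DotBox A)) \<in> \<Gamma>"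
    and y: "y \<noteq> x" "y \<notin> labels \<alpha>" "\<And>\<gamma>. \<gamma> \<in> \<Gamma> \<Longrightarrow> y \<notin> labels \<gamma>"
  shows "\<not> derivable (insert (Lab y (Neg A)) (insert (RelP x y) \<Gamma>)) \<alpha>"
proof
  assume "derivable (insert (Lab y (Neg A)) (insert (RelP x y) \<Gamma>)) \<alpha>"
  from target_cases[OF assms(1) this] show False
  proof
    assume "inconsistent (insert (Lab y (Neg A)) (insert (RelP x y) \<Gamma>))"
    then have "derivable (insert (RelP x y) \<Gamma>) (Lab y A)"
      by (rule derivable_RAA[OF inconsistent_derivable])
    then have "derivable \<Gamma> (Lab x (DotBox A))" using y(1,3) by (rule derivable_DotBoxI)
    with derivable_assm[OF assms(3)] have "derivable \<Gamma> (Lab x Bot)" by (rule derivable_ImpE)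
    then show False using assms(2) derivable_BotE by blast
  next
    assume "derivable (rels (insert (Lab y (Neg A)) (insert (RelP x y) \<Gamma>))) \<alpha>"
    then have "derivable (insert (RelP x y) (insert (RelP y y) \<Gamma>)) \<alpha>"
      by (rule derivable_mono) auto
    then have "derivable \<Gamma> \<alpha>" using y by (rule derivable_Class)
    then show False using assms(2) by contradiction
  qed
qed

definition spare :: "fm set \<Rightarrow> label set" where
  "spare \<Gamma> = - (\<Union>\<gamma>\<in>\<Gamma>. labels \<gamma>)"

lemma spare_insert [simp]: "infinite (spare (insert \<gamma> \<Gamma>)) \<longleftrightarrow> infinite (spare \<Gamma>)"
proof -
  have "spare (insert \<gamma> \<Gamma>) = spare \<Gamma> - labels \<gamma>" unfolding spare_def by auto
  then show ?thesis by simp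
qed

lemma ex_spare:
  assumes "infinite (spare \<Gamma>)"
  obtains y where "y \<noteq> x" "y \<notin> labels \<alpha>" "\<And>\<gamma>. \<gamma> \<in> \<Gamma> \<Longrightarrow> y \<notin> labels \<gamma>"
proof -
  have "infinite (spare \<Gamma> - insert x (labels \<alpha>))" using assms by simp
  then obtain y where "y \<in> spare \<Gamma> - insert x (labels \<alpha>)"
    by (metis finite.emptyI ex_in_conv)
  then show ?thesis using that unfolding spare_def by auto
qed

text \<open>All demands attached to a pair are bundled so that a single enumeration of pairs serves.
  Each is a positive membership condition, hence stays satisfied when \<open>\<Delta>\<close>
  grows.\<close>

definition saturated_at :: "fm set \<Rightarrow> label \<Rightarrow> mfm \<Rightarrow> bool" where
  "saturated_at \<Delta> x A \<longleftrightarrow>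
     (Lab x A \<in> \<Delta> \<or> Lab x (Neg A) \<in> \<Delta>) \<and>
     (\<exists>y. RelP x y \<in> \<Delta> \<and> RelP y y \<in> \<Delta>) \<and>
     (\<forall>B. A = Box B \<longrightarrow> Lab x A \<in> \<Delta> \<or> (\<exists>y. RelU x y \<in> \<Delta> \<and> Lab y (Neg B) \<in> \<Delta>)) \<and>
     (\<forall>B. A = DotBox B \<longrightarrow> Lab x A \<in> \<Delta> \<or> (\<exists>y. RelP x y \<in> \<Delta> \<and> Lab y (Neg B) \<in> \<Delta>))"

lemma saturated_at_mono: "saturated_at \<Gamma> x A \<Longrightarrow> \<Gamma> \<subseteq> \<Delta> \<Longrightarrow> saturated_at \<Delta> x A"
  unfolding saturated_at_def by blast

lemma saturation_step:
  assumes "target \<alpha>" "\<not> derivable \<Gamma> \<alpha>" "infinite (spare \<Gamma>)"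
  shows "\<exists>\<Delta>. \<Gamma> \<subseteq> \<Delta> \<and> \<not> derivable \<Delta> \<alpha> \<and> infinite (spare \<Delta>) \<and> saturated_at \<Delta> x A"
proof -
  obtain y where y: "y \<noteq> x" "y \<notin> labels \<alpha>" "\<And>\<gamma>. \<gamma> \<in> \<Gamma> \<Longrightarrow> y \<notin> labels \<gamma>"
    using ex_spare[OF assms(3)] by metis
  define \<Gamma>1 where "\<Gamma>1 = insert (RelP x y) (insert (RelP y y) \<Gamma>)"
  have 1: "\<not> derivable \<Gamma>1 \<alpha>" "infinite (spare \<Gamma>1)"
    unfolding \<Gamma>1_def using extend_class[OF assms(2) y] assms(3) by simp_all
  obtain B where B: "B = A \<or> B = Neg A" "\<not> derivable (insert (Lab x B) \<Gamma>1) \<alpha>"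
    using extend_decide[OF assms(1) 1(1)] by blast
  define \<Gamma>2 where "\<Gamma>2 = insert (Lab x B) \<Gamma>1"
  have 2: "\<not> derivable \<Gamma>2 \<alpha>" "infinite (spare \<Gamma>2)" "Lab x B \<in> \<Gamma>2" "\<Gamma> \<subseteq> \<Gamma>2"
    "RelP x y \<in> \<Gamma>2" "RelP y y \<in> \<Gamma>2"
    using B 1 unfolding \<Gamma>2_def \<Gamma>1_def by auto
  obtain z where z: "z \<noteq> x" "z \<notin> labels \<alpha>" "\<And>\<gamma>. \<gamma> \<in> \<Gamma>2 \<Longrightarrow> z \<notin> labels \<gamma>"
    using ex_spare[OF 2(2)] by metis
  \<comment> \<open>A further witness is called for exactly when a boxed formula was decided
    negatively.\<close>
  consider C where "A = Box C" "B = Neg A" | C where "A = DotBox C" "B = Neg A"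
    | "B = A \<or> (\<forall>C. A \<noteq> Box C \<and> A \<noteq> DotBox C)"
    using B(1) by blast
  then show ?thesis
  proof cases
    case (1 C)
    let ?\<Delta> = "insert (Lab z (Neg C)) (insert (RelU x z) \<Gamma>2)"
    have "\<not> derivable ?\<Delta> \<alpha>"
      by (rule extend_Box[OF assms(1) 2(1) _ z]) (use 1 2(3) in auto)
    moreover have "infinite (spare ?\<Delta>)" using 2(2) by simp
    moreover have "saturated_at ?\<Delta> x A"
      using 1 2(3,5,6) unfolding saturated_at_def by blast
    ultimately show ?thesis using 2(4) by (intro exI[of _ ?\<Delta>] conjI subset_insertI2)
  next
    case (2 C)
    let ?\<Delta> = "insert (Lab z (Neg C)) (insert (RelP x z) \<Gamma>2)"
    have "\<not> derivable ?\<Delta> \<alpha>"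
      by (rule extend_DotBox[OF assms(1) \<open>\<not> derivable \<Gamma>2 \<alpha>\<close> _ z]) (use 2 \<open>Lab x B \<in> \<Gamma>2\<close> in auto)
    moreover have "infinite (spare ?\<Delta>)" using \<open>infinite (spare \<Gamma>2)\<close> by simp
    moreover have "saturated_at ?\<Delta> x A"
      using 2 \<open>Lab x B \<in> \<Gamma>2\<close> \<open>RelP x y \<in> \<Gamma>2\<close> \<open>RelP y y \<in> \<Gamma>2\<close> unfolding saturated_at_def by blast
    ultimately show ?thesis
      using \<open>\<Gamma> \<subseteq> \<Gamma>2\<close> by (intro exI[of _ ?\<Delta>] conjI subset_insertI2)
  next
    case 3
    have "saturated_at \<Gamma>2 x A"
      using 3 B(1) 2(3,5,6) unfolding saturated_at_def by blast
    then show ?thesis using 2 by blast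
  qed
qed

instance mfm :: countable
  by countable_datatype

text \<open>Stage \<open>n\<close> serves the pair coded by \<open>n\<close>; by monotonicity one
  visit per pair suffices. The union still fails to derive \<open>\<alpha>\<close>, because a
  derivation has finitely many open assumptions and these lie in one stage.\<close>

lemma saturated_extension:
  assumes "target \<alpha>" "\<not> derivable \<Gamma> \<alpha>" "infinite (spare \<Gamma>)"
  obtains \<Delta> where "\<Gamma> \<subseteq> \<Delta>" "\<not> derivable \<Delta> \<alpha>" "\<And>x A. saturated_at \<Delta> x A"
proof -
  let ?good = "\<lambda>\<Delta>. \<Gamma> \<subseteq> \<Delta> \<and> \<not> derivable \<Delta> \<alpha> \<and> infinite (spare \<Delta>)"
  let ?step = "\<lambda>n \<Delta> \<Delta>'. \<Delta> \<subseteq> \<Delta>' \<and> (\<lambda>(x, A). saturated_at \<Delta>' x A) (from_nat n :: label \<times> mfm)"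
  have "\<exists>G. \<forall>n. ?good (G n) \<and> ?step n (G n) (G (Suc n))"
  proof (rule dependent_nat_choice)
    show "\<exists>\<Delta>. ?good \<Delta>" using assms by blast
  next
    fix \<Delta> n assume *: "?good \<Delta>"
    obtain x :: label and A :: mfm where n: "from_nat n = (x, A)" by fastforce
    from saturation_step[OF assms(1), of \<Delta> x A] *
    obtain \<Delta>' where "\<Delta> \<subseteq> \<Delta>'" "\<not> derivable \<Delta>' \<alpha>" "infinite (spare \<Delta>')" "saturated_at \<Delta>' x A"
      by blast
    then show "\<exists>\<Delta>'. ?good \<Delta>' \<and> ?step n \<Delta> \<Delta>'"
      using * n by (intro exI[of _ \<Delta>']) (simp, blast)
  qed
  then obtain G where "\<forall>n. ?good (G n) \<and> ?step n (G n) (G (Suc n))" ..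
  then have G: "?good (G n)" "?step n (G n) (G (Suc n))" for n
    by simp_all
  have mono: "G m \<subseteq> G n" if "m \<le> n" for m n
    by (rule lift_Suc_mono_le[OF _ that]) (use G(2) in blast)
  show ?thesis
  proof
    show "\<Gamma> \<subseteq> (\<Union>n. G n)" using G(1) by blast
    show "\<not> derivable (\<Union>n. G n) \<alpha>"
    proof
      assume "derivable (\<Union>n. G n) \<alpha>"
      then obtain S where S: "finite S" "S \<subseteq> (\<Union>n. G n)" "derivation S \<alpha>" by (rule derivableE)
      from S(1,2) have "\<exists>n. S \<subseteq> G n"
      proof (induction rule: finite_induct)
        case (insert \<gamma> S)
        then obtain m n where "\<gamma> \<in> G m" "S \<subseteq> G n" by blast
        then have "insert \<gamma> S \<subseteq> G (max m n)"
          using mono[of m "max m n"] mono[of n "max m n"] by auto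
        then show ?case ..
      qed simp
      then show False using derivableI[OF S(3)] G(1) by blast
    qed
    fix x A
    have "saturated_at (G (Suc (to_nat (x, A)))) x A"
      using G(2)[of "to_nat (x, A)"] by simp
    then show "saturated_at (\<Union>n. G n) x A" by (rule saturated_at_mono) blast
  qed
qed


section \<open>The canonical model\<close>

text \<open>The injection \<open>e\<close> places the worlds inside the given type
  \<open>'w\<close>.\<close>

locale saturated =
  fixes \<Delta> :: "fm set" and e :: "label \<Rightarrow> 'w"
  assumes consistent: "\<not> inconsistent \<Delta>"
    and saturated: "\<And>x A. saturated_at \<Delta> x A"
    and e: "inj e"
begin

text \<open>Deciding every formula closes \<open>\<Delta>\<close> under labelled consequences.
  Relational formulas are never decided, which is why the relations of the model are read off from
  \<open>derivable\<close> and not from membership.\<close>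

lemma derivable_Lab_iff: "derivable \<Delta> (Lab x A) \<longleftrightarrow> Lab x A \<in> \<Delta>"
proof
  assume d: "derivable \<Delta> (Lab x A)"
  show "Lab x A \<in> \<Delta>"
  proof (rule ccontr)
    assume "Lab x A \<notin> \<Delta>"
    then have "Lab x (Neg A) \<in> \<Delta>" using saturated[of x A] unfolding saturated_at_def by blast
    then have "derivable \<Delta> (Lab x Bot)" using d derivable_ImpE derivable_assm by blast
    then show False using consistent unfolding inconsistent_def by blast
  qed
qed (rule derivable_assm)

lemma Bot_notin: "Lab x Bot \<notin> \<Delta>"
  using consistent derivable_Lab_iff unfolding inconsistent_def by blast

lemma Neg_iff: "Lab x (Neg A) \<in> \<Delta> \<longleftrightarrow> Lab x A \<notin> \<Delta>"
  using saturated[of x A] Bot_notin derivable_ImpE[of \<Delta> x A Bot]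
  unfolding saturated_at_def derivable_Lab_iff by blast

lemma Imp_iff: "Lab x (Imp A B) \<in> \<Delta> \<longleftrightarrow> (Lab x A \<in> \<Delta> \<longrightarrow> Lab x B \<in> \<Delta>)"
proof
  assume "Lab x (Imp A B) \<in> \<Delta>"
  then show "Lab x A \<in> \<Delta> \<longrightarrow> Lab x B \<in> \<Delta>"
    using derivable_ImpE[of \<Delta> x A B] by (simp add: derivable_Lab_iff)
next
  assume *: "Lab x A \<in> \<Delta> \<longrightarrow> Lab x B \<in> \<Delta>"
  have "derivable (insert (Lab x A) \<Delta>) (Lab x B)"
  proof (cases "Lab x A \<in> \<Delta>")
    case True
    then show ?thesis using * by (auto intro: derivable_assm)
  next
    case False
    then have "derivable (insert (Lab x A) \<Delta>) (Lab x (Imp A Bot))"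
      by (auto simp: Neg_iff intro: derivable_assm)
    moreover have "derivable (insert (Lab x A) \<Delta>) (Lab x A)" by (auto intro: derivable_assm)
    ultimately have "derivable (insert (Lab x A) \<Delta>) (Lab x Bot)" by (rule derivable_ImpE)
    then show ?thesis by (rule derivable_BotE)
  qed
  then show "Lab x (Imp A B) \<in> \<Delta>" using derivable_ImpI derivable_Lab_iff by blast
qed

lemma Box_iff: "Lab x (Box A) \<in> \<Delta> \<longleftrightarrow> (\<forall>y. derivable \<Delta> (RelU x y) \<longrightarrow> Lab y A \<in> \<Delta>)"
  using saturated[of x "Box A"] derivable_BoxE[of \<Delta> x A] derivable_assm[of _ \<Delta>]
  unfolding saturated_at_def derivable_Lab_iff Neg_iff by blast

lemma DotBox_iff: "Lab x (DotBox A) \<in> \<Delta> \<longleftrightarrow> (\<forall>y. derivable \<Delta> (RelP x y) \<longrightarrow> Lab y A \<in> \<Delta>)"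
  using saturated[of x "DotBox A"] derivable_DotBoxE[of \<Delta> x A] derivable_assm[of _ \<Delta>]
  unfolding saturated_at_def derivable_Lab_iff Neg_iff by blast

text \<open>The second disjunct is what the fourth frame condition forces; the first restores
  reflexivity at labels without a derivable \<open>RelP x x\<close>.\<close>

definition same :: "label \<Rightarrow> label \<Rightarrow> bool" where
  "same x y \<longleftrightarrow> x = y \<or> derivable \<Delta> (RelP x x) \<and> derivable \<Delta> (RelP x y)"

lemma same_refl: "same x x"
  unfolding same_def by simp

lemma same_sym: "same x y \<Longrightarrow> same y x"
  unfolding same_def by (metis derivable_Psymm derivable_Ptrans)

lemma same_trans: "same x y \<Longrightarrow> same y z \<Longrightarrow> same x z"
  unfolding same_def by (metis derivable_Ptrans)

text \<open>A least representative stands for the equivalence class, so that a world is the image of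
  a label instead of a set of labels.\<close>

definition world :: "label \<Rightarrow> 'w" where
  "world x = e (LEAST y. same x y)"

lemma world_eq_iff: "world x = world y \<longleftrightarrow> same x y"
proof
  assume "world x = world y"
  then have "(LEAST z. same x z) = (LEAST z. same y z)"
    unfolding world_def using e by (simp add: inj_eq)
  then show "same x y"
    using LeastI[of "same x", OF same_refl] LeastI[of "same y", OF same_refl] same_sym same_trans
    by metis
next
  assume "same x y"
  then have "same x = same y" using same_sym same_trans by blast
  then show "world x = world y" unfolding world_def by simp
qed

definition canonical :: "'w model" where
  "canonical = \<lparr>
     worlds = range world,
     relU = {(world x, world y) | x y. derivable \<Delta> (RelU x y)},
     relP = {(world x, world y) | x y. derivable \<Delta> (RelP x y)},
     val = (\<lambda>w. {r. \<exists>x. w = world x \<and> Lab x (Atom r) \<in> \<Delta>})\<rparr>"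

lemma relU_canonical: "(world x, world y) \<in> relU canonical \<longleftrightarrow> derivable \<Delta> (RelU x y)"
proof
  assume "(world x, world y) \<in> relU canonical"
  then obtain u v where uv: "same x u" "same y v" "derivable \<Delta> (RelU u v)"
    unfolding canonical_def by (auto simp: world_eq_iff)
  have "derivable \<Delta> (RelU x u)" "derivable \<Delta> (RelU y v)"
    using uv(1,2) unfolding same_def by (auto intro: derivable_PUI derivable_Urefl)
  then show "derivable \<Delta> (RelU x y)" using uv(3) derivable_Utrans derivable_Usymm by blast
qed (auto simp: canonical_def)

lemma relP_canonical: "(world x, world y) \<in> relP canonical \<longleftrightarrow> derivable \<Delta> (RelP x y)"
proof
  assume "(world x, world y) \<in> relP canonical"
  \<comment> \<open>The second identification is oriented from \<open>v\<close> to \<open>y\<close>,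
    which leaves a chain from \<open>x\<close> through \<open>u\<close> and \<open>v\<close> to
    \<open>y\<close> for \<open>Ptrans\<close>.\<close>
  then obtain u v where uv: "same x u" "same v y" "derivable \<Delta> (RelP u v)"
    unfolding canonical_def by (auto simp: world_eq_iff dest: same_sym)
  then show "derivable \<Delta> (RelP x y)" unfolding same_def by (metis derivable_Ptrans)
qed (auto simp: canonical_def)

text \<open>Relations respect \<open>same\<close> by transitivity; for labelled formulas this is the
  work of \<open>Psub1\<close>.\<close>

lemma same_Lab:
  assumes "same x y" "Lab x A \<in> \<Delta>"
  shows "Lab y A \<in> \<Delta>"
  using assms derivable_Psub1[of \<Delta> "Lab x A" x y] unfolding same_def
  by (auto simp: derivable_Lab_iff)

lemma worlds_canonical: "worlds canonical = range world"
  and rel_canonical_subset: "relU canonical \<subseteq> range world \<times> range world"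
    "relP canonical \<subseteq> range world \<times> range world"
  unfolding canonical_def by auto

lemma is_model_canonical: "is_model canonical"
proof -
  have "equiv (range world) (relU canonical)"
    unfolding equiv_def
  proof (intro conjI)
    show "relU canonical \<subseteq> range world \<times> range world" by (rule rel_canonical_subset)
    show "refl_on (range world) (relU canonical)"
      by (rule refl_onI) (auto simp: relU_canonical derivable_Urefl)
    show "sym (relU canonical)"
    proof (rule symI)
      fix v w assume "(v, w) \<in> relU canonical"
      moreover from this obtain x y where "v = world x" "w = world y"
        using rel_canonical_subset by blast
      ultimately show "(w, v) \<in> relU canonical"
        by (auto simp: relU_canonical intro: derivable_Usymm)
    qed
    show "trans (relU canonical)"
    proof (rule transI)
      fix u v w assume "(u, v) \<in> relU canonical" "(v, w) \<in> relU canonical"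
      moreover from this obtain x y z where "u = world x" "v = world y" "w = world z"
        using rel_canonical_subset by blast
      ultimately show "(u, w) \<in> relU canonical"
        by (auto simp: relU_canonical intro: derivable_Utrans)
    qed
  qed
  moreover have "(v, w) \<in> relU canonical" if "(v, w) \<in> relP canonical" for v w
    using that unfolding canonical_def by (auto intro: derivable_PUI)
  moreover have "(u, w) \<in> relP canonical"
    if uvw: "(u, v) \<in> relP canonical" "(v, w) \<in> relP canonical" for u v w
  proof -
    obtain x y z where "u = world x" "v = world y" "w = world z"
      using uvw rel_canonical_subset by blast
    then show ?thesis using uvw by (auto simp: relP_canonical intro: derivable_Ptrans)
  qed
  moreover have "\<exists>w\<in>range world. (v, w) \<in> relP canonical \<and> (w, w) \<in> relP canonical"
    if "v \<in> range world" for v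
  proof -
    obtain x where x: "v = world x" using \<open>v \<in> range world\<close> by blast
    \<comment> \<open>\<open>Bot\<close> is an arbitrary choice: the witness for
      \<open>Class\<close> is demanded at every pair.\<close>
    obtain y where "RelP x y \<in> \<Delta>" "RelP y y \<in> \<Delta>"
      using saturated[of x Bot] unfolding saturated_at_def by blast
    then show ?thesis using x by (auto simp: relP_canonical intro!: derivable_assm bexI[of _ "world y"])
  qed
  moreover have "v = w" if vw: "(v, v) \<in> relP canonical" "(v, w) \<in> relP canonical" for v w
  proof -
    obtain x y where "v = world x" "w = world y"
      using vw rel_canonical_subset by blast
    then show ?thesis using vw by (simp add: relP_canonical world_eq_iff same_def)
  qed
  ultimately show ?thesis
    unfolding is_model_def is_frame_def worlds_canonical using rel_canonical_subset(2) by blast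
qed

lemma truth: "true_at canonical (world x) A \<longleftrightarrow> Lab x A \<in> \<Delta>"
proof (induction A arbitrary: x)
  case Bot
  then show ?case by (simp add: Bot_notin)
next
  case (Atom r)
  have "true_at canonical (world x) (Atom r) \<longleftrightarrow> (\<exists>y. same x y \<and> Lab y (Atom r) \<in> \<Delta>)"
    by (simp add: canonical_def world_eq_iff)
  then show ?case using same_refl same_sym same_Lab by blast
next
  case (Imp A B)
  then show ?case by (simp add: Imp_iff)
next
  case (Box A)
  have "(\<forall>w. (world x, w) \<in> relU canonical \<longrightarrow> true_at canonical w A) \<longleftrightarrow>
      (\<forall>y. (world x, world y) \<in> relU canonical \<longrightarrow> true_at canonical (world y) A)"
    using rel_canonical_subset by blast
  then show ?case by (simp add: Box_iff Box.IH relU_canonical)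
next
  case (DotBox A)
  have "(\<forall>w. (world x, w) \<in> relP canonical \<longrightarrow> true_at canonical w A) \<longleftrightarrow>
      (\<forall>y. (world x, world y) \<in> relP canonical \<longrightarrow> true_at canonical (world y) A)"
    using rel_canonical_subset by blast
  then show ?case by (simp add: DotBox_iff DotBox.IH relP_canonical)
qed

lemma satisfies_canonical: "satisfies canonical world \<gamma> \<longleftrightarrow> derivable \<Delta> \<gamma>"
  by (cases \<gamma>) (simp_all add: relU_canonical relP_canonical truth derivable_Lab_iff)

end


section \<open>Completeness\<close>

lemma target_countermodel:
  assumes inf: "infinite (UNIV :: 'w set)" and "target \<alpha>" "\<not> derivable \<Gamma> \<alpha>"
  obtains M :: "'w model" and I
  where "is_model M" "is_interpretation M I" "\<And>\<gamma>. \<gamma> \<in> \<Gamma> \<Longrightarrow> satisfies M I \<gamma>" "\<not> satisfies M I \<alpha>"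
proof -
  let ?f = "\<lambda>x :: label. 2 * x"
  have "target (rename ?f \<alpha>)"
    using \<open>target \<alpha>\<close> by (cases \<alpha>) (auto simp: target_def)
  moreover have "\<not> derivable (rename ?f ` \<Gamma>) (rename ?f \<alpha>)"
    using assms(3) derivable_rename_inj[of ?f \<Gamma> \<alpha>] by (auto simp: inj_def)
  moreover have "infinite (spare (rename ?f ` \<Gamma>))"
  proof -
    \<comment> \<open>After doubling, the odd labels occur nowhere.\<close>
    have "range (\<lambda>n :: nat. Suc (2 * n)) \<subseteq> spare (rename ?f ` \<Gamma>)"
      unfolding spare_def by (auto simp: labels_rename) presburger
    moreover have "infinite (range (\<lambda>n :: nat. Suc (2 * n)))"
      by (simp add: finite_image_iff inj_on_def)
    ultimately show ?thesis by (rule infinite_super)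
  qed
  ultimately obtain \<Delta> where \<Delta>: "rename ?f ` \<Gamma> \<subseteq> \<Delta>" "\<not> derivable \<Delta> (rename ?f \<alpha>)"
      "\<And>x A. saturated_at \<Delta> x A"
    using saturated_extension by blast
  obtain e :: "nat \<Rightarrow> 'w" where "inj e" using infinite_countable_subset[OF inf] by blast
  then interpret saturated \<Delta> e
    using \<Delta>(2,3) inconsistent_derivable by unfold_locales blast+
  \<comment> \<open>Composing with the doubling map undoes the renaming, so the model refutes the
    original formulas.\<close>
  have sat: "satisfies canonical (world \<circ> ?f) \<gamma> \<longleftrightarrow> derivable \<Delta> (rename ?f \<gamma>)" for \<gamma>
    by (simp add: satisfies_canonical flip: satisfies_rename)
  show ?thesis
  proof
    show "is_model canonical" by (rule is_model_canonical)
    show "is_interpretation canonical (world \<circ> ?f)"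
      by (simp add: is_interpretation_def worlds_canonical)
    show "satisfies canonical (world \<circ> ?f) \<gamma>" if "\<gamma> \<in> \<Gamma>" for \<gamma>
      unfolding sat using that \<Delta>(1) by (auto intro: derivable_assm)
    show "\<not> satisfies canonical (world \<circ> ?f) \<alpha>" unfolding sat by (rule \<Delta>(2))
  qed
qed

lemma completeness:
  assumes inf: "infinite (UNIV :: 'w set)" and ent: "entails TYPE('w) \<Gamma> \<alpha>"
  shows "derivable \<Gamma> \<alpha>"
proof (rule ccontr)
  assume nd: "\<not> derivable \<Gamma> \<alpha>"
  \<comment> \<open>Reduction to a target: relational goals stay, while for \<open>Lab x A\<close>
    its negation joins the assumptions and the goal becomes \<open>Lab x Bot\<close>. A countermodel
    of the new pair is one of the old.\<close>
  have "\<exists>\<Gamma>' \<alpha>'. target \<alpha>' \<and> \<not> derivable \<Gamma>' \<alpha>' \<and>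
    (\<forall>(M :: 'w model) I. (\<forall>\<gamma>\<in>\<Gamma>'. satisfies M I \<gamma>) \<and> \<not> satisfies M I \<alpha>' \<longrightarrow>
       (\<forall>\<gamma>\<in>\<Gamma>. satisfies M I \<gamma>) \<and> \<not> satisfies M I \<alpha>)"
  proof (cases \<alpha>)
    case (Lab x A)
    then have "\<not> derivable (insert (Lab x (Neg A)) \<Gamma>) (Lab x Bot)"
      using nd derivable_RAA by blast
    then show ?thesis
      using Lab by (intro exI[of _ "insert (Lab x (Neg A)) \<Gamma>"] exI[of _ "Lab x Bot"])
        (auto simp: target_def)
  qed (use nd in \<open>auto simp: target_def intro!: exI[of _ \<Gamma>] exI[of _ \<alpha>]\<close>)
  then obtain \<Gamma>' \<alpha>' where *: "target \<alpha>'" "\<not> derivable \<Gamma>' \<alpha>'"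
    "\<And>(M :: 'w model) I. (\<forall>\<gamma>\<in>\<Gamma>'. satisfies M I \<gamma>) \<Longrightarrow> \<not> satisfies M I \<alpha>' \<Longrightarrow>
       (\<forall>\<gamma>\<in>\<Gamma>. satisfies M I \<gamma>) \<and> \<not> satisfies M I \<alpha>"
    by blast
  obtain M :: "'w model" and I where "is_model M" "is_interpretation M I"
    "\<And>\<gamma>. \<gamma> \<in> \<Gamma>' \<Longrightarrow> satisfies M I \<gamma>" "\<not> satisfies M I \<alpha>'"
    using target_countermodel[OF inf *(1,2)] by metis
  then show False using *(3)[of M I] ent unfolding entails_def by blast
qed

theorem mainTheorem2:
  fixes \<Gamma> :: "fm set" and \<alpha> :: fm
  assumes "infinite (UNIV :: 'w set)"
  shows "derivable \<Gamma> \<alpha> \<longleftrightarrow> entails TYPE('w) \<Gamma> \<alpha>"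
proof
  assume "derivable \<Gamma> \<alpha>"
  then show "entails TYPE('w) \<Gamma> \<alpha>"
    unfolding entails_def by (elim derivableE) (blast intro: soundness)
next
  assume "entails TYPE('w) \<Gamma> \<alpha>"
  with assms show "derivable \<Gamma> \<alpha>" by (rule completeness)
qed

end
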